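(* Let $G$ be a $2$-connected split graph with no induced subgraph isomorphic to the snare or to an $n$-nova for any $n \geq 2$. Then $G$ has a Hamiltonian cycle.
   Context: Graphs are finite, without loops or parallel edges. A Hamiltonian cycle of $G$ is a (not necessarily induced) subgraph of $G$ which is a cycle containing every vertex of $G$. A split graph is a graph whose vertex set can be partitioned into a stable set and a clique. The net is the graph with vertex set $\{a,b,c,a',b',c'\}$ and edge set $\{a'b', b'c', a'c', aa', bb', cc'\}$. The snare is the graph obtained from the net by adding a vertex adjacent to every vertex of the net. For $n \geq 2$, an $n$-sun is the graph obtained from a cycle $C$ with $2n$ vertices $v_1,\dots,v_{2n}$ in this order along $C$ by adding all edges $v_{2i}v_{2j}$ for distinct $i,j \in \{1,\dots,n\}$; an $n$-nova is obtained from an $n$-sun by adding a new vertex $w$ and the edges $wv_{2i}$ for all $i \in \{1,\dots,n\}$. *)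

theory Defs
  imports "HOL-Library.Ramsey"
begin

text \<open>A graph is a pair of a vertex set and a set of two-element vertex sets; loops and
  parallel edges are thereby excluded. The predicates \<^verbatim>\<open>clique\<close> and
  \<^verbatim>\<open>indep\<close> are those of the Ramsey library theory, which uses the
  same representation of edges.\<close>

type_synonym 'a graph = "'a set \<times> 'a set set"

abbreviation verts :: "'a graph \<Rightarrow> 'a set" where "verts \<equiv> fst"

abbreviation edges :: "'a graph \<Rightarrow> 'a set set" where "edges \<equiv> snd"

definition simple_graph :: "'a graph \<Rightarrow> bool" where
  "simple_graph G \<longleftrightarrow> finite (verts G) \<and> (\<forall>e \<in> edges G. e \<subseteq> verts G \<and> card e = 2)"

definition adj :: "'a graph \<Rightarrow> 'a \<Rightarrow> 'a \<Rightarrow> bool" where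
  "adj G u v \<longleftrightarrow> {u, v} \<in> edges G"

definition subgraph :: "'a graph \<Rightarrow> 'a graph \<Rightarrow> bool" where
  "subgraph H G \<longleftrightarrow> simple_graph H \<and> verts H \<subseteq> verts G \<and> edges H \<subseteq> edges G"

definition induced :: "'a graph \<Rightarrow> 'a set \<Rightarrow> 'a graph" where
  "induced G X = (verts G \<inter> X, {e \<in> edges G. e \<subseteq> X})"

definition isomorphic :: "'a graph \<Rightarrow> 'b graph \<Rightarrow> bool" where
  "isomorphic G H \<longleftrightarrow> (\<exists>f. bij_betw f (verts G) (verts H) \<and>
     (\<forall>u \<in> verts G. \<forall>v \<in> verts G. adj G u v \<longleftrightarrow> adj H (f u) (f v)))"

definition contains_induced :: "'a graph \<Rightarrow> 'b graph \<Rightarrow> bool" where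
  "contains_induced G H \<longleftrightarrow> (\<exists>X \<subseteq> verts G. isomorphic (induced G X) H)"

definition connected_graph :: "'a graph \<Rightarrow> bool" where
  "connected_graph G \<longleftrightarrow> verts G \<noteq> {} \<and> (\<forall>u \<in> verts G. \<forall>v \<in> verts G. (adj G)\<^sup>*\<^sup>* u v)"

definition k_connected :: "nat \<Rightarrow> 'a graph \<Rightarrow> bool" where
  "k_connected k G \<longleftrightarrow> card (verts G) > k \<and>
     (\<forall>X \<subseteq> verts G. card X < k \<longrightarrow> connected_graph (induced G (verts G - X)))"

definition split_graph :: "'a graph \<Rightarrow> bool" where
  "split_graph G \<longleftrightarrow> (\<exists>S K. S \<union> K = verts G \<and> S \<inter> K = {} \<and>
     indep S (edges G) \<and> clique K (edges G))"

text \<open>The cycle through the listed vertices, in this order; a genuine cycle only for a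
  list of at least three distinct vertices.\<close>

definition cycle_of :: "'a list \<Rightarrow> 'a graph" where
  "cycle_of vs = (set vs, {{vs ! i, vs ! (Suc i mod length vs)} | i. i < length vs})"

definition is_cycle :: "'a graph \<Rightarrow> bool" where
  "is_cycle C \<longleftrightarrow> (\<exists>vs. length vs \<ge> 3 \<and> distinct vs \<and> C = cycle_of vs)"

definition hamiltonian_cycle :: "'a graph \<Rightarrow> 'a graph \<Rightarrow> bool" where
  "hamiltonian_cycle G C \<longleftrightarrow> subgraph C G \<and> is_cycle C \<and> verts C = verts G"

definition add_vertex :: "'a graph \<Rightarrow> 'a \<Rightarrow> 'a set \<Rightarrow> 'a graph" where
  "add_vertex G w N = (insert w (verts G), edges G \<union> {{w, x} | x. x \<in> N})"

text \<open>The vertices $a, b, c, a', b', c'$ of the net are numbered $1, \dots, 6$.\<close>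

definition net :: "nat graph" where
  "net = ({1, 2, 3, 4, 5, 6}, {{4, 5}, {5, 6}, {4, 6}, {1, 4}, {2, 5}, {3, 6}})"

definition snare :: "nat graph" where
  "snare = add_vertex net 0 (verts net)"

text \<open>The vertex $v_i$ of the sun is the number $i$, and $w$ is $0$. Both are meaningful
  for $n \geq 2$ only.\<close>

definition sun :: "nat \<Rightarrow> nat graph" where
  "sun n = (let C = cycle_of [1..<2 * n + 1] in
     (verts C, edges C \<union> {{2 * i, 2 * j} | i j. i \<in> {1..n} \<and> j \<in> {1..n} \<and> i \<noteq> j}))"

definition nova :: "nat \<Rightarrow> nat graph" where
  "nova n = add_vertex (sun n) 0 {2 * i | i. i \<in> {1..n}}"

end

theory Submission
  imports Defs
begin

text \<open>Let \<open>S\<close> be the stable set and \<open>K\<close> the clique. If \<open>S \<union> K\<close> can be covered by disjoint paths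
  that alternate between \<open>K\<close> and \<open>S\<close> and have both ends in \<open>K\<close>, clique edges link these paths to
  a Hamiltonian cycle. When every vertex of \<open>K\<close> has at most two neighbours in \<open>S\<close>, a cover that
  uses as much of \<open>S\<close> as possible is complete, unless a missing vertex of \<open>S\<close> closes one of its paths
  to an induced alternating cycle with no neighbours in \<open>K\<close> outside; such a cycle is
  Hamiltonian or yields a nova. If some \<open>a \<in> S\<close> is adjacent to all of \<open>K\<close>, this applies to
  \<open>S - {a}\<close>, and \<open>a\<close> closes the cycle. Otherwise some \<open>u \<in> K\<close> has three neighbours
  in \<open>S\<close>; as there is no snare, two of them share a second neighbour, and the absence of
  the 2-nova then forces \<open>S\<close> to have three or four vertices in an explicitly known position.\<close>

section \<open>Induced copies, the adjacency of novas, and cycles given by lists\<close>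

lemma adj_sym: "adj G u v \<Longrightarrow> adj G v u"
  by (simp add: adj_def insert_commute)

text \<open>\<open>isomorphic\<close> asks for a map out of the induced subgraph, while explicit
  copies come as a numbering \<open>g\<close> of the pattern; the inverse of \<open>g\<close> is the
  required map.\<close>

lemma contains_induced_embedding:
  assumes "inj_on g (verts H)" and "g ` verts H \<subseteq> verts G"
    and "\<And>x y. x \<in> verts H \<Longrightarrow> y \<in> verts H \<Longrightarrow> adj G (g x) (g y) \<longleftrightarrow> adj H x y"
  shows "contains_induced G H"
proof -
  let ?X = "g ` verts H" and ?f = "inv_into (verts H) g"
  have "verts (induced G ?X) = ?X"
    using assms(2) by (auto simp: induced_def)
  moreover have "bij_betw ?f ?X (verts H)"
    using assms(1) by (simp add: bij_betw_imageI bij_betw_inv_into)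
  moreover have "adj (induced G ?X) u v \<longleftrightarrow> adj H (?f u) (?f v)" if "u \<in> ?X" "v \<in> ?X" for u v
  proof -
    have "adj (induced G ?X) u v \<longleftrightarrow> adj G u v"
      using that by (auto simp: induced_def adj_def)
    then show ?thesis
      using that assms(1,3) by (auto simp: inv_into_f_f)
  qed
  ultimately show ?thesis
    unfolding contains_induced_def isomorphic_def using assms(2) by metis
qed

lemma verts_nova:
  assumes "n \<ge> 1"
  shows "verts (nova n) = {0..2 * n}"
  using assms by (auto simp: nova_def add_vertex_def sun_def cycle_of_def Let_def)

text \<open>The vertex \<open>w\<close> is numbered \<open>0\<close> and joined to the even vertices, which form a clique, so it
  counts as one more even vertex.\<close>

lemma adj_nova:
  assumes "n \<ge> 2" and "x \<le> 2 * n" and "y \<le> 2 * n"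
  shows "adj (nova n) x y \<longleftrightarrow>
    x \<noteq> y \<and> even x \<and> even y \<or> 1 \<le> x \<and> y = Suc x \<or> 1 \<le> y \<and> x = Suc y \<or>
    x = 1 \<and> y = 2 * n \<or> x = 2 * n \<and> y = 1"
    (is "_ \<longleftrightarrow> ?R x y")
proof -
  let ?l = "[1..<2 * n + 1]"
  \<comment> \<open>Positions count from 0, so entry \<open>i\<close> is the vertex
    \<open>Suc i\<close>; only the last edge, from \<open>2 * n\<close> to \<open>1\<close>, wraps
    around.\<close>
  have nth: "?l ! i = Suc i" if "i < 2 * n" for i
    using that by (simp del: upt_Suc)
  have ce: "e \<in> edges (cycle_of ?l) \<longleftrightarrow>
      (\<exists>i<2 * n. e = {Suc i, if Suc i = 2 * n then 1 else Suc (Suc i)})" for e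
  proof -
    have "length ?l = 2 * n" by simp
    then have "e \<in> edges (cycle_of ?l) \<longleftrightarrow>
        (\<exists>i<2 * n. e = {?l ! i, ?l ! (Suc i mod (2 * n))})"
      by (simp only: cycle_of_def snd_conv mem_Collect_eq) blast
    moreover have "?l ! (Suc i mod (2 * n)) = (if Suc i = 2 * n then 1 else Suc (Suc i))"
      if "i < 2 * n" for i
      using that nth[of "Suc i"] nth[of 0] by (auto simp del: upt_Suc)
    ultimately show ?thesis
      using nth by (simp del: upt_Suc cong: conj_cong)
  qed
  have "adj (nova n) x y \<longleftrightarrow> {x, y} \<in> edges (cycle_of ?l) \<or>
      (\<exists>i j. {x, y} = {2 * i, 2 * j} \<and> i \<in> {1..n} \<and> j \<in> {1..n} \<and> i \<noteq> j) \<or>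
      (\<exists>z. {x, y} = {0, z} \<and> (\<exists>i. z = 2 * i \<and> i \<in> {1..n}))"
    unfolding adj_def nova_def add_vertex_def sun_def Let_def
    by (simp only: fst_conv snd_conv Un_iff mem_Collect_eq disj_assoc)
  also have "\<dots> \<longleftrightarrow> ?R x y"
  proof
    assume "{x, y} \<in> edges (cycle_of ?l) \<or>
      (\<exists>i j. {x, y} = {2 * i, 2 * j} \<and> i \<in> {1..n} \<and> j \<in> {1..n} \<and> i \<noteq> j) \<or>
      (\<exists>z. {x, y} = {0, z} \<and> (\<exists>i. z = 2 * i \<and> i \<in> {1..n}))"
    then show "?R x y"
      unfolding ce by (auto simp: doubleton_eq_iff split: if_splits)
  next
    have cyc: "{u, v} \<in> edges (cycle_of ?l)" if "1 \<le> u"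
        "u < 2 * n \<and> v = Suc u \<or> u = 2 * n \<and> v = 1" for u v
      using that unfolding ce by (intro exI[of _ "u - 1"]) auto
    assume "?R x y"
    then consider (even) "x \<noteq> y" "even x" "even y" | (up) "1 \<le> x" "y = Suc x"
      | (down) "1 \<le> y" "x = Suc y" | (close) "x = 1" "y = 2 * n" | (close') "x = 2 * n" "y = 1"
      by blast
    then show "{x, y} \<in> edges (cycle_of ?l) \<or>
      (\<exists>i j. {x, y} = {2 * i, 2 * j} \<and> i \<in> {1..n} \<and> j \<in> {1..n} \<and> i \<noteq> j) \<or>
      (\<exists>z. {x, y} = {0, z} \<and> (\<exists>i. z = 2 * i \<and> i \<in> {1..n}))"
    proof cases
      case even
      then obtain i j where ij: "x = 2 * i" "y = 2 * j" by (auto elim!: evenE)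
      show ?thesis
      proof (cases "i = 0 \<or> j = 0")
        case True
        \<comment> \<open>One of \<open>i\<close> and \<open>j\<close> is 0, so \<open>x + y\<close>
          and \<open>i + j\<close> are the end other than \<open>0\<close> and its half, whichever
          of the two ends is \<open>0\<close>.\<close>
        then have "\<exists>z. {x, y} = {0, z} \<and> (\<exists>i. z = 2 * i \<and> i \<in> {1..n})"
          using ij even(1) assms(2,3)
          by (intro exI[of _ "x + y"]) (auto simp: insert_commute intro: exI[of _ "i + j"])
        then show ?thesis by blast
      next
        case False
        then have "i \<in> {1..n}" "j \<in> {1..n}" "i \<noteq> j" using ij even(1) assms(2,3) by auto
        then show ?thesis using ij by blast
      qed
    next
      case up then show ?thesis using cyc[of x y] assms by auto
    next
      case down then show ?thesis using cyc[of y x] assms by (auto simp: insert_commute)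
    next
      case close then show ?thesis using cyc[of y x] assms by (auto simp: insert_commute)
    next
      case close' then show ?thesis using cyc[of x y] assms by auto
    qed
  qed
  finally show ?thesis .
qed

lemma hamiltonian_cycle_listI:
  assumes "simple_graph G" and "distinct c" and "set c = verts G" and "length c \<ge> 3"
    and succ: "successively (adj G) c" and close: "adj G (last c) (hd c)"
  shows "\<exists>C. hamiltonian_cycle G C"
proof -
  have edge: "{c ! i, c ! (Suc i mod length c)} \<in> edges G" if "i < length c" for i
  proof (cases "Suc i < length c")
    case True
    then show ?thesis using succ by (auto simp: successively_conv_nth adj_def)
  next
    case False
    then have "Suc i = length c" using that by simp
    moreover from this have "last c = c ! i" by (metis diff_Suc_1 last_conv_nth list.size(3) nat.simps(3))
    ultimately show ?thesis
      using close by (cases c) (auto simp: adj_def)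
  qed
  then have "subgraph (cycle_of c) G"
    using assms(1,3) unfolding subgraph_def simple_graph_def cycle_of_def
    by (fastforce simp: subset_iff)
  then show ?thesis
    using assms by (auto simp: hamiltonian_cycle_def is_cycle_def cycle_of_def intro!: exI[of _ "cycle_of c"])
qed

text \<open>After deletion of \<open>x\<close> the graph is connected and still has a vertex besides
  \<open>v\<close>; a walk from \<open>v\<close> to that vertex starts with the wanted edge.\<close>

lemma two_connected_neighbour:
  assumes "k_connected 2 G" and "v \<in> verts G" and "x \<noteq> v"
  obtains y where "adj G v y" "y \<noteq> x"
proof -
  \<comment> \<open>The intersection covers the case that \<open>x\<close> is not a vertex of
    \<open>G\<close>.\<close>
  let ?W = "verts G - ({x} \<inter> verts G)"
  have "card ({x} \<inter> verts G) < 2" 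
    by (metis Int_lower1 card_1_singleton_iff card_mono finite.emptyI finite.insertI le_imp_less_Suc One_nat_def Suc_1)
  then have con: "connected_graph (induced G ?W)"
    using assms(1) unfolding k_connected_def by blast
  have "card (verts G) > 2" using assms(1) by (simp add: k_connected_def)
  then have "\<not> verts G \<subseteq> {v, x}"
    by (metis (no_types, lifting) assms(3) card_2_iff card_mono finite.emptyI finite.insertI not_less)
  then obtain z where z: "z \<in> verts G" "z \<noteq> v" "z \<noteq> x" by blast
  have "(adj (induced G ?W))\<^sup>*\<^sup>* v z"
    using con z assms(2,3) unfolding connected_graph_def by (auto simp: induced_def)
  then obtain y where "adj (induced G ?W) v y"
    using z(2) by (metis converse_rtranclpE)
  then have "adj G v y" "y \<noteq> x" by (auto simp: induced_def adj_def)
  then show ?thesis by (rule that)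
qed

subsection \<open>Alternating paths in split graphs\<close>

locale split_partition =
  fixes G :: "'a graph" and S K :: "'a set"
  assumes simple: "simple_graph G"
    and partition: "S \<union> K = verts G" "S \<inter> K = {}"
    and indep: "indep S (edges G)"
    and clique: "clique K (edges G)"
begin

lemma finite_S: "finite S" and finite_K: "finite K"
  using simple partition(1) by (metis finite_Un simple_graph_def)+

lemma adj_verts: "adj G u v \<Longrightarrow> u \<in> S \<union> K \<and> v \<in> S \<union> K"
  using simple partition(1) unfolding simple_graph_def adj_def by blast

lemma adj_irrefl: "\<not> adj G u u"
proof
  assume "adj G u u"
  then have "card {u, u} = 2" using simple by (auto simp: simple_graph_def adj_def)
  then show False by simp
qed

lemma not_adj_S: "s \<in> S \<Longrightarrow> t \<in> S \<Longrightarrow> \<not> adj G s t"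
  using indep adj_irrefl unfolding indep_def adj_def by (metis insert_absorb2)

lemma adj_K: "k \<in> K \<Longrightarrow> l \<in> K \<Longrightarrow> adj G k l \<longleftrightarrow> k \<noteq> l"
  using clique adj_irrefl unfolding clique_def adj_def by (metis insert_absorb2)

lemma neighbour_S: "s \<in> S \<Longrightarrow> adj G s k \<Longrightarrow> k \<in> K"
  using not_adj_S adj_verts by blast

text \<open>Every edge has its ends in \<open>S \<union> K\<close>, so the equivalence excludes
  exactly the edges inside one of the two sets.\<close>

definition crossing :: "'a \<Rightarrow> 'a \<Rightarrow> bool" where
  "crossing u v \<longleftrightarrow> adj G u v \<and> (u \<in> S \<longleftrightarrow> v \<in> K)"

lemma crossing_sym: "crossing u v \<Longrightarrow> crossing v u"
  using adj_sym[of G u v] adj_verts[of u v] partition(2) by (auto simp: crossing_def)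

lemma crossing_SK: "s \<in> S \<Longrightarrow> crossing s k \<longleftrightarrow> adj G s k"
  using neighbour_S by (auto simp: crossing_def)

lemma crossing_KS: "s \<in> S \<Longrightarrow> crossing k s \<longleftrightarrow> adj G s k"
  using crossing_SK crossing_sym by blast

lemma crossing_K: "k \<in> K \<Longrightarrow> crossing k v \<Longrightarrow> v \<in> S"
  using adj_verts partition(2) by (auto simp: crossing_def)

text \<open>A single vertex of \<open>K\<close> counts as such a path; in this way vertices of
  \<open>K\<close> not joined to \<open>S\<close> enter a cover.\<close>

definition alternating :: "'a list \<Rightarrow> bool" where
  "alternating p \<longleftrightarrow> p \<noteq> [] \<and> distinct p \<and> hd p \<in> K \<and> last p \<in> K \<and> successively crossing p"

lemma alternating_rev: "alternating p \<Longrightarrow> alternating (rev p)"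
  unfolding alternating_def
  by (auto simp: hd_rev last_rev intro: successively_mono crossing_sym)

lemma alternating_join:
  assumes "alternating p" "alternating q" "set p \<inter> set q = {}" "s \<in> S"
    "s \<notin> set p" "s \<notin> set q" "adj G s (last p)" "adj G s (hd q)"
  shows "alternating (p @ s # q)"
  using assms unfolding alternating_def
  by (auto simp: successively_append_iff successively_Cons crossing_SK crossing_KS)

lemma alternating_nth:
  assumes "alternating p" "i < length p"
  shows "if even i then p ! i \<in> K else p ! i \<in> S"
  using assms(2)
proof (induction i)
  case 0
  then show ?case using assms(1) by (simp add: alternating_def hd_conv_nth)
next
  case (Suc i)
  then have "crossing (p ! i) (p ! Suc i)"
    using assms(1) by (simp add: alternating_def successively_nth)
  then show ?case
    using Suc adj_verts partition(2) by (auto simp: crossing_def split: if_splits)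
qed

lemma alternating_odd_length:
  assumes "alternating p"
  shows "odd (length p)"
proof -
  have "last p = p ! (length p - 1)" "last p \<in> K" "p \<noteq> []"
    using assms by (auto simp: alternating_def last_conv_nth)
  then show ?thesis
    using alternating_nth[OF assms, of "length p - 1"] partition(2) by (cases "length p") (auto split: if_splits)
qed

section \<open>The degree bound and covers by alternating paths\<close>

definition degree_le_two :: "'a set \<Rightarrow> bool" where
  "degree_le_two T \<longleftrightarrow> T \<subseteq> S \<and> (\<forall>k. \<forall>a\<in>T. \<forall>b\<in>T. \<forall>c\<in>T.
     adj G a k \<and> adj G b k \<and> adj G c k \<longrightarrow> a = b \<or> a = c \<or> b = c)"

lemma degree_le_twoD:
  "degree_le_two T \<Longrightarrow> {a, b, c} \<subseteq> T \<Longrightarrow> adj G a k \<Longrightarrow> adj G b k \<Longrightarrow> adj G c k \<Longrightarrow>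
    a = b \<or> a = c \<or> b = c"
  unfolding degree_le_two_def by blast

text \<open>An inner vertex of \<open>p\<close> in \<open>K\<close> already has two neighbours in
  \<open>T\<close>, its predecessor and its successor on \<open>p\<close>; \<open>t\<close> would be
  a third.\<close>

lemma alternating_end:
  assumes p: "alternating p" and T: "degree_le_two T" "set p \<inter> S \<subseteq> T"
    and k: "k \<in> set p" and t: "t \<in> T" "t \<notin> set p" "adj G t k"
  shows "k = hd p \<or> k = last p"
proof (rule ccontr)
  assume ends: "\<not> ?thesis"
  have "k \<in> K" using t T(1) neighbour_S by (auto simp: degree_le_two_def)
  obtain xs ys where xs: "p = xs @ k # ys" using k by (meson split_list)
  with ends have ne: "xs \<noteq> []" "ys \<noteq> []" by auto
  have "crossing (last xs) k" "crossing k (hd ys)"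
    using p ne by (auto simp: xs alternating_def successively_append_iff successively_Cons)
  then have "last xs \<in> S" "hd ys \<in> S" "adj G (last xs) k" "adj G (hd ys) k"
    using \<open>k \<in> K\<close> crossing_K crossing_sym crossing_SK by blast+
  moreover have "last xs \<in> set p" "hd ys \<in> set p" "last xs \<noteq> hd ys"
    using p ne by (auto simp: xs alternating_def) (metis disjoint_iff hd_in_set last_in_set)
  ultimately show False
    using degree_le_twoD[OF T(1), of "last xs" "hd ys" t k] t T(2) by blast
qed

lemma alternating_orient:
  assumes "alternating p" "k = hd p \<or> k = last p"
  obtains q where "alternating q" "set q = set p" "hd q = k"
proof (cases "k = hd p")
  case True
  then show ?thesis using that assms(1) by blast
next
  case False
  then show ?thesis
    using that[of "rev p"] alternating_rev assms by (auto simp: hd_rev)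
qed

text \<open>Only the covered part of \<open>S\<close> varies; all of \<open>K\<close> is always
  covered, if need be by one-vertex paths.\<close>

definition path_cover :: "'a set \<Rightarrow> 'a list set \<Rightarrow> bool" where
  "path_cover T P \<longleftrightarrow> finite P \<and> (\<forall>p\<in>P. alternating p) \<and>
     (\<forall>p\<in>P. \<forall>q\<in>P. p \<noteq> q \<longrightarrow> set p \<inter> set q = {}) \<and> \<Union> (set ` P) = T \<union> K"

text \<open>The path \<open>r\<close> absorbs the paths in \<open>Q\<close> and the new vertex
  \<open>s\<close>. It is disjoint from the remaining paths because \<open>s\<close> lies on none of
  them.\<close>

lemma path_cover_merge:
  assumes P: "path_cover T P" and "Q \<subseteq> P" and r: "alternating r"
    and set_r: "set r = insert s (\<Union> (set ` Q))" and s: "s \<notin> T \<union> K"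
  shows "path_cover (insert s T) (insert r (P - Q))"
proof -
  have pw: "\<forall>p\<in>P. \<forall>q\<in>P. p \<noteq> q \<longrightarrow> set p \<inter> set q = {}"
    and un: "\<Union> (set ` P) = T \<union> K" and fin: "finite P" and alt: "\<forall>p\<in>P. alternating p"
    using P by (simp_all add: path_cover_def)
  have dr: "set p \<inter> set r = {}" if p: "p \<in> P - Q" for p
  proof -
    have "set p \<inter> set q = {}" if "q \<in> Q" for q
      using that p pw assms(2) by (metis Diff_iff subsetD)
    moreover have "s \<notin> set p" using p s un by blast
    ultimately show ?thesis unfolding set_r by auto
  qed
  have "\<Union> (set ` insert r (P - Q)) = insert s (\<Union> (set ` P))"
    using set_r assms(2) by auto
  then have "\<Union> (set ` insert r (P - Q)) = insert s T \<union> K"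
    unfolding un by simp
  moreover have "\<forall>p\<in>insert r (P - Q). \<forall>q\<in>insert r (P - Q). p \<noteq> q \<longrightarrow> set p \<inter> set q = {}"
    using pw dr by (metis Diff_iff Int_commute insert_iff)
  ultimately show ?thesis
    using fin alt r by (simp add: path_cover_def)
qed

text \<open>Take a cover of a maximal \<open>U \<subseteq> T\<close> and \<open>s \<in> T - U\<close>. By the degree bound all neighbours of \<open>s\<close>
  are ends of paths; if they lay on two paths, \<open>s\<close> would join these, so they are the two ends
  of one path \<open>p\<close>. An edge from an inner vertex \<open>t\<close> of \<open>p\<close> to another path \<open>q\<close> would allow to open the
  cycle through \<open>s\<close> and \<open>p\<close> at \<open>t\<close> and to append \<open>q\<close>.\<close>

lemma path_cover_or_closed:
  assumes T: "degree_le_two T"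
    and two: "\<And>s. s \<in> T \<Longrightarrow> \<exists>x y. x \<noteq> y \<and> adj G s x \<and> adj G s y"
  obtains (cover) P where "path_cover T P"
  | (closed) p s where "alternating p" "set p \<inter> S \<subseteq> T" "s \<in> T" "s \<notin> set p"
      "hd p \<noteq> last p" "adj G s (hd p)" "adj G s (last p)"
      "\<And>k t. k \<in> K \<Longrightarrow> k \<notin> set p \<Longrightarrow> t \<in> S \<inter> set (s # p) \<Longrightarrow> \<not> adj G t k"
proof -
  have TS: "T \<subseteq> S" using T by (simp add: degree_le_two_def)
  have finT: "finite T" using TS finite_S finite_subset by blast
  define C where "C = {U. U \<subseteq> T \<and> (\<exists>P. path_cover U P)}"
  \<comment> \<open>The one-vertex paths cover \<open>K\<close>, so some set is coverable and a
    maximal one exists.\<close>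
  have "path_cover {} ((\<lambda>k. [k]) ` K)"
    by (auto simp: path_cover_def finite_K alternating_def)
  then have "C \<noteq> {}" unfolding C_def by blast
  moreover have "finite C" using finT by (simp add: C_def)
  ultimately obtain U where "U \<in> C" and max: "\<And>V. V \<in> C \<Longrightarrow> U \<subseteq> V \<Longrightarrow> U = V"
    using finite_has_maximal[of C] by metis
  then obtain P where U: "U \<subseteq> T" and P: "path_cover U P" by (auto simp: C_def)
  have alt: "alternating p" if "p \<in> P" for p
    using P that by (simp add: path_cover_def)
  have pU: "set p \<inter> S \<subseteq> U" if "p \<in> P" for p
  proof -
    have "set p \<subseteq> U \<union> K" using P that by (auto simp: path_cover_def)
    then show ?thesis using partition(2) by blast
  qed
  have dis: "set p \<inter> set q = {}" if "p \<in> P" "q \<in> P" "p \<noteq> q" for p q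
    using P that by (simp add: path_cover_def)
  have ex: "\<exists>p\<in>P. k \<in> set p" if "k \<in> K" for k
  proof -
    have "k \<in> \<Union> (set ` P)" using P that by (simp add: path_cover_def)
    then show ?thesis by simp
  qed
  have no_merge: False if "s \<in> T - U" "Q \<subseteq> P" "alternating r" "set r = insert s (\<Union> (set ` Q))" for s Q r
  proof -
    have "s \<notin> U \<union> K" using that(1) TS partition(2) by blast
    then have "path_cover (insert s U) (insert r (P - Q))"
      by (rule path_cover_merge[OF P that(2,3,4)])
    then have "insert s U \<in> C"
      using that(1) U by (auto simp: C_def)
    then show False using max[of "insert s U"] that(1) by blast
  qed
  have ends: "k = hd p \<or> k = last p" if "p \<in> P" "k \<in> set p" "t \<in> T" "t \<notin> set p" "adj G t k" for p k t
    using alternating_end[OF alt[OF that(1)] T _ that(2-5)] pU[OF that(1)] U by blast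
  show thesis
  proof (cases "U = T")
    case True
    then show thesis using cover P by blast
  next
    case False
    then obtain s where s: "s \<in> T" "s \<notin> U" using U by blast
    have sp: "s \<notin> set p" if "p \<in> P" for p using that s pU TS by blast
    obtain x y where xy: "x \<noteq> y" "adj G s x" "adj G s y" using two s(1) by blast
    have NK: "k \<in> K" if "adj G s k" for k using that s(1) TS neighbour_S by blast
    obtain p where p: "p \<in> P" "x \<in> set p" using ex NK xy by blast
    have all: "k \<in> set p" if k: "adj G s k" for k
    proof (rule ccontr)
      assume "k \<notin> set p"
      obtain q where q: "q \<in> P" "k \<in> set q" using ex NK k by blast
      have "p \<noteq> q" using q \<open>k \<notin> set p\<close> by blast
      obtain p' where p': "alternating p'" "set p' = set p" "hd p' = x"
        using alternating_orient alt[OF p(1)] ends[OF p s(1) sp[OF p(1)] xy(2)] by metis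
      obtain q' where q': "alternating q'" "set q' = set q" "hd q' = k"
        using alternating_orient alt[OF q(1)] ends[OF q s(1) sp[OF q(1)] k] by metis
      have "alternating (rev p' @ s # q')"
        using p' q' k xy(2) s TS sp[OF p(1)] sp[OF q(1)] dis[OF p(1) q(1) \<open>p \<noteq> q\<close>]
        by (intro alternating_join alternating_rev) (auto simp: last_rev)
      moreover have "set (rev p' @ s # q') = insert s (\<Union> (set ` {p, q}))"
        using p'(2) q'(2) by auto
      ultimately show False
        using no_merge[of s "{p, q}"] s p(1) q(1) by blast
    qed
    have "{x, y} = {hd p, last p}"
      using ends[OF p(1) all s(1) sp[OF p(1)]] xy by blast
    then have hl: "hd p \<noteq> last p" "adj G s (hd p)" "adj G s (last p)"
      using xy by (auto simp: doubleton_eq_iff)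
    have "\<not> adj G t k" if k: "k \<in> K" "k \<notin> set p" and t: "t \<in> S \<inter> set (s # p)" for k t
    proof
      assume tk: "adj G t k"
      then have "t \<noteq> s" using all k(2) by blast
      then have tp: "t \<in> set p" "t \<in> S" using t by auto
      obtain q where q: "q \<in> P" "k \<in> set q" using ex k by blast
      have "p \<noteq> q" using q k(2) by blast
      then have pq: "set p \<inter> set q = {}" using dis p(1) q(1) by blast
      have "t \<in> T" using tp pU[OF p(1)] U by blast
      obtain q' where q': "alternating q'" "set q' = set q" "hd q' = k"
        using alternating_orient alt[OF q(1)] ends[OF q \<open>t \<in> T\<close> _ tk] pq tp by (metis disjoint_iff)
      obtain xs ys where xs: "p = xs @ t # ys" using tp by (meson split_list)
      have "hd p \<in> K" "last p \<in> K" using alt[OF p(1)] by (auto simp: alternating_def)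
      then have ne: "xs \<noteq> []" "ys \<noteq> []" using tp partition(2) by (auto simp: xs)
      have cr: "crossing (last xs) t" "crossing t (hd ys)"
        using alt[OF p(1)] ne by (auto simp: xs alternating_def successively_append_iff successively_Cons)
      then have adjs: "adj G t (last xs)" "adj G t (hd ys)" "last xs \<in> K" "hd ys \<in> K"
        using tp crossing_KS crossing_SK neighbour_S by blast+
      have "alternating xs" "alternating ys"
        using alt[OF p(1)] ne adjs by (auto simp: xs alternating_def successively_append_iff successively_Cons)
      \<comment> \<open>The path runs from the successor of \<open>t\<close> to the end of
        \<open>p\<close>, through \<open>s\<close> to the start of \<open>p\<close>, on to
        \<open>t\<close>, and from there into \<open>q'\<close> at \<open>k\<close>.\<close>
      then have "alternating ((ys @ s # xs) @ t # q')"
        using q' ne hl(2,3) adjs tk tp s TS sp[OF p(1)] sp[OF q(1)] pq alt[OF p(1)]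
        by (intro alternating_join) (auto simp: xs alternating_def)
      moreover have "set ((ys @ s # xs) @ t # q') = insert s (\<Union> (set ` {p, q}))"
        using q'(2) by (auto simp: xs)
      ultimately show False
        using no_merge[of s "{p, q}"] s p(1) q(1) by blast
    qed
    then show thesis
      using closed[of p s] alt[OF p(1)] pU[OF p(1)] U s(1) sp[OF p(1)] hl by blast
  qed
qed

section \<open>From path covers to Hamiltonian cycles\<close>

lemma path_cover_list:
  assumes "finite P" "P \<noteq> {}" "\<forall>p\<in>P. alternating p"
    "\<forall>p\<in>P. \<forall>q\<in>P. p \<noteq> q \<longrightarrow> set p \<inter> set q = {}"
  shows "\<exists>c. c \<noteq> [] \<and> distinct c \<and> set c = \<Union> (set ` P) \<and> hd c \<in> K \<and> last c \<in> K \<and>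
    successively (adj G) c"
  using assms
proof (induction P rule: finite_ne_induct)
  case (singleton p)
  then have "alternating p" by simp
  then have "successively (adj G) p"
    unfolding alternating_def by (auto intro: successively_mono simp: crossing_def)
  then show ?case
    using \<open>alternating p\<close> by (auto simp: alternating_def)
next
  case (insert p P)
  then obtain c where c: "c \<noteq> []" "distinct c" "set c = \<Union> (set ` P)" "hd c \<in> K" "last c \<in> K"
    "successively (adj G) c" by blast
  have p: "alternating p" using insert.prems by simp
  then have "successively (adj G) p"
    unfolding alternating_def by (auto intro: successively_mono simp: crossing_def)
  moreover have "set p \<inter> set c = {}"
    using insert.prems(2) insert.hyps(3) c(3) by auto
  \<comment> \<open>Both vertices lie in \<open>K\<close>, so once they differ a clique edge links
    \<open>p\<close> to \<open>c\<close>.\<close>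
  moreover from this have "last p \<noteq> hd c"
    using p c(1) by (metis alternating_def disjoint_iff hd_in_set last_in_set)
  ultimately show ?case
    using c p adj_K[of "last p" "hd c"] by (intro exI[of _ "p @ c"]) (auto simp: alternating_def successively_append_iff)
qed

lemma cover_cycle_list:
  assumes "path_cover T P" "K \<noteq> {}"
  obtains c where "c \<noteq> []" "distinct c" "set c = T \<union> K" "hd c \<in> K" "last c \<in> K"
    "successively (adj G) c"
proof -
  have "P \<noteq> {}" using assms by (auto simp: path_cover_def)
  then show ?thesis
    using that path_cover_list[of P] assms(1) unfolding path_cover_def by metis
qed

text \<open>The ends of the linked list lie in \<open>K\<close> and differ, since the list has at
  least three entries; a clique edge closes it.\<close>

lemma hamiltonian_of_cover:
  assumes "path_cover S P" "card (verts G) \<ge> 3" "K \<noteq> {}"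
  shows "\<exists>C. hamiltonian_cycle G C"
proof -
  obtain c where c: "c \<noteq> []" "distinct c" "set c = S \<union> K" "hd c \<in> K" "last c \<in> K"
    "successively (adj G) c" using cover_cycle_list assms by blast
  have len: "length c \<ge> 3" using assms(2) c(2,3) partition(1) distinct_card by metis
  have "last c \<noteq> hd c"
  proof
    assume "last c = hd c"
    moreover have "last c = c ! (length c - 1)" "hd c = c ! 0"
      using c(1) by (simp_all add: last_conv_nth hd_conv_nth)
    ultimately show False
      using c(1) len nth_eq_iff_index_eq[OF c(2), of "length c - 1" 0] by auto
  qed
  then show ?thesis
    using hamiltonian_cycle_listI[OF simple c(2)] c len partition(1) adj_K by blast
qed

section \<open>Induced novas and snares\<close>

text \<open>The vertex \<open>s\<close> closes \<open>p\<close> to a cycle alternating between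
  \<open>S\<close> and \<open>K\<close>. By the degree bound it has no chord between
  \<open>S\<close> and \<open>K\<close>, so with \<open>w\<close> as hub it induces a nova. The hub
  may come from \<open>K\<close> or from \<open>S\<close>.\<close>

lemma closed_nova:
  assumes p: "alternating p" and T: "degree_le_two T" "set p \<inter> S \<subseteq> T"
    and s: "s \<in> T" "s \<notin> set p" "adj G s (hd p)" "adj G s (last p)" and hl: "hd p \<noteq> last p"
    and w: "w \<in> verts G" "w \<notin> set (s # p)"
      "\<And>k. k \<in> K \<inter> set p \<Longrightarrow> adj G w k" "\<And>t. t \<in> S \<inter> set (s # p) \<Longrightarrow> \<not> adj G w t"
  shows "\<exists>n\<ge>2. contains_induced G (nova n)"
proof -
  have "length p \<noteq> 1" using hl by (cases p) auto
  moreover have odd: "odd (length p)" using alternating_odd_length p by blast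
  ultimately have len: "length p \<ge> 3" by (cases "length p = 2") (auto elim!: oddE)
  define n where "n = Suc (length p) div 2"
  define c where "c = s # p"
  have n: "length c = 2 * n" "n \<ge> 2" using odd len by (auto simp: n_def c_def)
  have "s \<in> S" using s(1) T(1) by (auto simp: degree_le_two_def)
  have cS: "c ! i \<in> S" if "i < 2 * n" "even i" for i
    using alternating_nth[OF p, of "i - 1"] \<open>s \<in> S\<close> that n(1) by (cases i) (auto simp: c_def)
  have cK: "c ! i \<in> K" if "i < 2 * n" "odd i" for i
    using alternating_nth[OF p, of "i - 1"] that n(1) by (cases i) (auto simp: c_def)
  have cT: "c ! i \<in> T" if "i < 2 * n" "even i" for i
    using cS[OF that] nth_mem[of i c] that(1) n(1) T(2) s(1) by (auto simp: c_def)
  have dc: "distinct c" using p s(2) by (simp add: c_def alternating_def)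
  have pne: "p \<noteq> []" using p by (simp add: alternating_def)
  have cyc: "adj G (c ! i) (c ! Suc i)" if "Suc i < 2 * n" for i
  proof (cases i)
    case 0
    then show ?thesis using s(3) pne by (simp add: c_def hd_conv_nth)
  next
    case (Suc m)
    then have "crossing (p ! m) (p ! Suc m)"
      using p that n(1) by (auto simp: alternating_def c_def intro: successively_nth)
    then show ?thesis using Suc by (simp add: c_def crossing_def)
  qed
  have close: "adj G (c ! 0) (c ! (2 * n - 1))"
  proof -
    have "last c = c ! (2 * n - 1)"
      unfolding n(1)[symmetric] by (rule last_conv_nth) (simp add: c_def)
    moreover have "last c = last p" using pne by (simp add: c_def)
    ultimately have "c ! (2 * n - 1) = last p" by simp
    then show ?thesis using s(4) by (simp add: c_def)
  qed
  have inj: "c ! i = c ! j \<longleftrightarrow> i = j" if "i < 2 * n" "j < 2 * n" for i j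
    using that dc n(1) nth_eq_iff_index_eq by metis
  have SK: "adj G (c ! i) (c ! j) \<longleftrightarrow> j = Suc i \<or> i = Suc j \<or> i = 0 \<and> j = 2 * n - 1"
    if i: "i < 2 * n" "even i" and j: "j < 2 * n" "odd j" for i j
  proof
    assume ij: "adj G (c ! i) (c ! j)"
    \<comment> \<open>The positions \<open>i'\<close> and \<open>j - 1\<close> are the two next to
      \<open>j\<close> on the cycle, with wrap-around to \<open>s\<close> at position 0. Their
      entries are two neighbours of \<open>c ! j\<close> in \<open>T\<close>, so \<open>i\<close>
      must be one of them.\<close>
    define i' where "i' = (if j = 2 * n - 1 then 0 else Suc j)"
    have i': "i' < 2 * n" "even i'" "adj G (c ! i') (c ! j)" "i' \<noteq> j - 1"
      using j close cyc[of j] n(2) by (auto simp: i'_def intro: adj_sym)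
    have j': "j - 1 < 2 * n" "even (j - 1)" "adj G (c ! (j - 1)) (c ! j)"
      using j cyc[of "j - 1"] by (auto elim!: oddE)
    have "c ! i = c ! i' \<or> c ! i = c ! (j - 1) \<or> c ! i' = c ! (j - 1)"
      using degree_le_twoD[OF T(1), of "c ! i" "c ! i'" "c ! (j - 1)" "c ! j"] cT i i' j' ij by auto
    then have "i = i' \<or> i = j - 1" using inj i i' j' by metis
    then show "j = Suc i \<or> i = Suc j \<or> i = 0 \<and> j = 2 * n - 1"
      using j(2) by (auto simp: i'_def split: if_splits elim!: oddE)
  next
    assume "j = Suc i \<or> i = Suc j \<or> i = 0 \<and> j = 2 * n - 1"
    then show "adj G (c ! i) (c ! j)"
      using cyc[of i] cyc[of j] close i j by (auto intro: adj_sym)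
  qed
  \<comment> \<open>The hub is \<open>0\<close> and the cycle of the nova starts at
    \<open>1\<close>, so positions in \<open>c\<close> shift by one: odd numbers fall on
    \<open>S\<close>, positive even ones on \<open>K\<close>.\<close>
  define g where "g x = (if x = 0 then w else c ! (x - 1))" for x
  have wc: "w \<noteq> c ! i" if "i < 2 * n" for i
    using w(2) that n(1) nth_mem[of i c] by (auto simp: c_def)
  have wK: "adj G w (c ! i)" if "i < 2 * n" "odd i" for i
  proof -
    have "c ! i \<in> set c" using that n(1) by simp
    then have "c ! i \<in> set p" using cK[OF that] \<open>s \<in> S\<close> partition(2) by (auto simp: c_def)
    then show ?thesis using cK[OF that] w(3) by blast
  qed
  have wS: "\<not> adj G w (c ! i)" if "i < 2 * n" "even i" for i
    using cS[OF that] w(4) that n(1) nth_mem[of i c] unfolding c_def by fastforce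
  \<comment> \<open>Adjacency is symmetric, so \<open>par\<close> admits only one order when exactly
    one of the two is the hub, or when the parities differ; the other order is recovered at the
    end.\<close>
  have ng: "adj G (g x) (g y) \<longleftrightarrow> adj (nova n) x y"
    if xy: "x \<le> 2 * n" "y \<le> 2 * n" and par: "x = 0 \<or> y \<noteq> 0 \<and> (odd x \<or> even y)" for x y
  proof -
    consider "x = 0" "y = 0" | "x = 0" "y \<noteq> 0" "even y" | "x = 0" "odd y"
      | "x \<noteq> 0" "y \<noteq> 0" "even x" "even y" | "odd x" "odd y" | "odd x" "y \<noteq> 0" "even y"
      using par by force
    then show ?thesis
    proof cases
      case 1 then show ?thesis by (simp add: g_def adj_irrefl adj_nova n)
    next
      case 2 then show ?thesis using wK[of "y - 1"] xy by (simp add: g_def adj_nova n)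
    next
      case 3
      then have "y \<noteq> 0" by (cases y) auto
      then show ?thesis using 3 wS[of "y - 1"] xy n(2) by (auto simp: g_def adj_nova)
    next
      case 4
      then have "c ! (x - 1) \<in> K" "c ! (y - 1) \<in> K" using xy cK by auto
      then have "adj G (g x) (g y) \<longleftrightarrow> x \<noteq> y"
        using 4 xy inj[of "x - 1" "y - 1"] by (auto simp: g_def adj_K)
      moreover have "adj (nova n) x y \<longleftrightarrow> x \<noteq> y"
        using 4 xy n(2) by (auto simp: adj_nova)
      ultimately show ?thesis by simp
    next
      case 5
      then have "x \<noteq> 0" "y \<noteq> 0" by (auto intro!: Nat.gr0I)
      then have "c ! (x - 1) \<in> S" "c ! (y - 1) \<in> S" using xy 5 cS by auto
      then have "\<not> adj G (g x) (g y)" using \<open>x \<noteq> 0\<close> \<open>y \<noteq> 0\<close> by (simp add: g_def not_adj_S)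
      moreover have "\<not> adj (nova n) x y" using 5 xy n(2) by (auto simp: adj_nova)
      ultimately show ?thesis by simp
    next
      case 6
      then have "x \<noteq> 0" by (auto intro!: Nat.gr0I)
      then have "adj G (g x) (g y) \<longleftrightarrow>
          y - 1 = Suc (x - 1) \<or> x - 1 = Suc (y - 1) \<or> x - 1 = 0 \<and> y - 1 = 2 * n - 1"
        using 6 xy SK[of "x - 1" "y - 1"] by (simp add: g_def)
      moreover have "adj (nova n) x y \<longleftrightarrow> y = Suc x \<or> x = Suc y \<or> x = 1 \<and> y = 2 * n"
        using 6 \<open>x \<noteq> 0\<close> xy n(2) by (auto simp: adj_nova)
      moreover have "y - 1 = Suc (x - 1) \<longleftrightarrow> y = Suc x" "x - 1 = Suc (y - 1) \<longleftrightarrow> x = Suc y"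
        "x - 1 = 0 \<longleftrightarrow> x = 1" "y - 1 = 2 * n - 1 \<longleftrightarrow> y = 2 * n"
        using 6 \<open>x \<noteq> 0\<close> n(2) by auto
      ultimately show ?thesis by simp
    qed
  qed
  have "contains_induced G (nova n)"
  proof (rule contains_induced_embedding[of g])
    have v: "verts (nova n) = {0..2 * n}" using n(2) verts_nova by simp
    show "inj_on g (verts (nova n))"
    proof (rule inj_onI)
      fix x y assume "x \<in> verts (nova n)" "y \<in> verts (nova n)" "g x = g y"
      moreover from this have "x = 0 \<or> x - 1 < 2 * n" "y = 0 \<or> y - 1 < 2 * n"
        unfolding v by auto
      ultimately show "x = y"
        unfolding v using wc[of "x - 1"] wc[of "y - 1"] inj[of "x - 1" "y - 1"] n(2)
        by (auto simp: g_def split: if_splits)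
    qed
    have "c ! i \<in> verts G" if "i < 2 * n" for i
      using cS[OF that] cK[OF that] partition(1) by blast
    then show "g ` verts (nova n) \<subseteq> verts G"
      unfolding v using w(1) n(2) by (auto simp: g_def)
    show "adj G (g x) (g y) \<longleftrightarrow> adj (nova n) x y"
      if "x \<in> verts (nova n)" "y \<in> verts (nova n)" for x y
    proof (cases "x = 0 \<or> y \<noteq> 0 \<and> (odd x \<or> even y)")
      case True
      then show ?thesis using that ng[of x y] unfolding v by simp
    next
      case False
      then have "y = 0 \<or> x \<noteq> 0 \<and> (odd y \<or> even x)" by auto
      then have "adj G (g y) (g x) \<longleftrightarrow> adj (nova n) y x"
        using that ng[of y x] unfolding v by simp
      then show ?thesis using adj_sym by metis
    qed
  qed
  then show ?thesis using n(2) by blast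
qed

text \<open>The private neighbours \<open>x\<close>, \<open>y\<close>, \<open>z\<close> form the
  triangle of the net, \<open>a\<close>, \<open>b\<close>, \<open>c\<close> hang on them, and
  \<open>u\<close> is adjacent to all six.\<close>

lemma snare_of_private_neighbours:
  assumes S: "a \<in> S" "b \<in> S" "c \<in> S"
    and u: "adj G a u" "adj G b u" "adj G c u"
    and x: "adj G a x" "\<not> adj G b x" "\<not> adj G c x"
    and y: "\<not> adj G a y" "adj G b y" "\<not> adj G c y"
    and z: "\<not> adj G a z" "\<not> adj G b z" "adj G c z"
  shows "contains_induced G snare"
proof -
  define g where "g = nth [u, a, b, c, x, y, z]"
  have K: "u \<in> K" "x \<in> K" "y \<in> K" "z \<in> K" using S u x y z neighbour_S by blast+
  have v: "verts snare = {0, 1, 2, 3, 4, 5, 6}"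
    by (auto simp: snare_def add_vertex_def net_def)
  have g: "g 0 = u" "g 1 = a" "g (Suc 0) = a" "g 2 = b" "g 3 = c" "g 4 = x" "g 5 = y" "g 6 = z"
    by (simp_all add: g_def)
  have ne: "u \<noteq> x" "u \<noteq> y" "u \<noteq> z" "x \<noteq> y" "x \<noteq> z" "y \<noteq> z" "a \<noteq> b" "a \<noteq> c" "b \<noteq> c"
    using u x y z by auto
  have ne': "s \<noteq> k" "k \<noteq> s" if "s \<in> S" "k \<in> K" for s k using that partition(2) by auto
  have edges: "edges snare = {{0, 1}, {0, 2}, {0, 3}, {0, 4}, {0, 5}, {0, 6},
      {4, 5}, {5, 6}, {4, 6}, {1, 4}, {2, 5}, {3, 6}}"
  proof -
    have "edges snare = edges net \<union> (\<lambda>v. {0, v}) ` verts net"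
      unfolding snare_def add_vertex_def by (simp only: snd_conv) blast
    then show ?thesis by (simp add: net_def)
  qed
  have sym: "adj G k s \<longleftrightarrow> adj G s k" if "s \<in> S" "k \<in> K" for s k
    using adj_sym by metis
  show ?thesis
  proof (rule contains_induced_embedding[of g])
    show "inj_on g (verts snare)"
      unfolding v inj_on_def using ne ne' S K by (simp add: g ne[symmetric])
    show "g ` verts snare \<subseteq> verts G"
      unfolding v using S K partition(1) by (auto simp: g)
    have "\<forall>i\<in>verts snare. \<forall>j\<in>verts snare. adj G (g i) (g j) \<longleftrightarrow> adj snare i j"
      unfolding v adj_def[of snare] edges
      using S K u x y z ne by (simp add: g adj_K not_adj_S sym doubleton_eq_iff ne[symmetric])
    then show "adj G (g i) (g j) \<longleftrightarrow> adj snare i j" if "i \<in> verts snare" "j \<in> verts snare" for i j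
      using that by blast
  qed
qed

end

subsection \<open>Split graphs without snares and novas\<close>

text \<open>The first two assumptions are the form in which 2-connectedness enters the
  argument.\<close>

locale snare_nova_free = split_partition +
  assumes two_neighbours: "\<And>s. s \<in> S \<Longrightarrow> \<exists>x y. x \<noteq> y \<and> adj G s x \<and> adj G s y"
    and three_vertices: "card (verts G) \<ge> 3"
    and no_snare: "\<not> contains_induced G snare"
    and no_nova: "\<And>n. n \<ge> 2 \<Longrightarrow> \<not> contains_induced G (nova n)"
begin

lemma K_nonempty: "K \<noteq> {}"
proof
  assume "K = {}"
  moreover have "verts G \<noteq> {}" using three_vertices by (cases "verts G = {}") auto
  ultimately obtain s where "s \<in> S" using partition(1) by blast
  then show False using two_neighbours neighbour_S \<open>K = {}\<close> by blast
qed

text \<open>This is the case of the path \<open>k\<close>, \<open>t\<close>, \<open>l\<close> closed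
  by \<open>s\<close>; the degree bound is automatic for the two-element set
  \<open>{s, t}\<close>.\<close>

lemma no_two_nova:
  assumes "s \<in> S" "t \<in> S" "s \<noteq> t" "k \<noteq> l" "adj G s k" "adj G s l" "adj G t k" "adj G t l"
    and w: "w \<in> verts G" "w \<notin> {s, t}" "adj G w k" "adj G w l" "\<not> adj G w s" "\<not> adj G w t"
  shows False
proof -
  have K: "k \<in> K" "l \<in> K" using assms neighbour_S by blast+
  have ne: "s \<noteq> k" "s \<noteq> l" "t \<noteq> k" "t \<noteq> l" "s \<notin> K" "t \<notin> K" "k \<notin> S" "l \<notin> S"
    using K assms(1,2) partition(2) by auto
  have "degree_le_two {s, t}" using assms by (auto simp: degree_le_two_def)
  moreover have "alternating [k, t, l]"
    using assms K ne by (auto simp: alternating_def crossing_SK crossing_KS)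
  moreover have "w \<noteq> k" "w \<noteq> l" using w adj_irrefl by auto
  ultimately have "\<exists>n\<ge>2. contains_induced G (nova n)"
    using assms ne by (intro closed_nova[of "[k, t, l]" "{s, t}" s w]) auto
  then show False using no_nova by blast
qed

text \<open>A vertex \<open>w\<close> of \<open>K\<close> missed by both \<open>s\<close> and
  \<open>t\<close> would be adjacent to \<open>k\<close> and \<open>l\<close>, hence the hub of a
  2-nova.\<close>

lemma two_common_cover:
  assumes "s \<in> S" "t \<in> S" "s \<noteq> t" "k \<noteq> l" "adj G s k" "adj G s l" "adj G t k" "adj G t l"
    and w: "w \<in> K"
  shows "adj G s w \<or> adj G t w"
proof (rule ccontr)
  assume not: "\<not> ?thesis"
  have "k \<in> K" "l \<in> K" using assms neighbour_S by blast+
  then have "adj G w k" "adj G w l" using w adj_K not assms by metis+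
  then show False
    using no_two_nova[OF assms(1-8), of w] w not adj_sym[of G w] assms(1,2) partition by blast
qed

text \<open>As \<open>S\<close> is stable, the third vertex would be the hub of a 2-nova.\<close>

lemma no_two_common_of_three:
  assumes "a \<in> S" "b \<in> S" "c \<in> S" "a \<noteq> b" "a \<noteq> c" "b \<noteq> c" "k \<noteq> l"
    "adj G a k" "adj G a l" "adj G b k" "adj G b l" "adj G c k" "adj G c l"
  shows False
  using no_two_nova[of a b k l c] assms not_adj_S partition(1) by blast

section \<open>The two cases settled by path covers\<close>

text \<open>Three vertices of \<open>S - {a}\<close> with a common neighbour would have private
  neighbours and yield a snare, so \<open>S - {a}\<close> obeys the degree bound. A closed path
  would give a nova with hub \<open>a\<close>; hence there is a cover, and \<open>a\<close> joins
  the ends of the resulting list.\<close>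

lemma hamiltonian_if_full:
  assumes a: "a \<in> S" and full: "\<And>k. k \<in> K \<Longrightarrow> adj G a k"
  shows "\<exists>C. hamiltonian_cycle G C"
proof -
  have deg: "degree_le_two (S - {a})"
    unfolding degree_le_two_def
  proof (intro conjI allI ballI impI)
    fix u b c d assume T: "b \<in> S - {a}" "c \<in> S - {a}" "d \<in> S - {a}"
      and u: "adj G b u \<and> adj G c u \<and> adj G d u"
    show "b = c \<or> b = d \<or> c = d"
    proof (rule ccontr)
      assume ne: "\<not> ?thesis"
      \<comment> \<open>Since \<open>a\<close> is adjacent to \<open>u\<close> and \<open>k\<close>,
        a common neighbour \<open>k\<close> of \<open>s\<close> and \<open>t\<close> would give
        three vertices of \<open>S\<close> sharing both.\<close>
      have sole: "\<not> adj G t k" if "s \<in> S - {a}" "t \<in> S - {a}" "s \<noteq> t" "k \<noteq> u"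
          "adj G s u" "adj G t u" "adj G s k" for s t k
      proof
        assume "adj G t k"
        moreover have "k \<in> K" "u \<in> K" using that neighbour_S by blast+
        ultimately show False
          using no_two_common_of_three[of a s t u k] full that a by blast
      qed
      have other: "\<exists>k. k \<noteq> u \<and> adj G s k" if "s \<in> S - {a}" for s
        using two_neighbours[of s] that by (metis DiffD1)
      obtain x y z where "x \<noteq> u" "adj G b x" "y \<noteq> u" "adj G c y" "z \<noteq> u" "adj G d z"
        using other T by metis
      then have "contains_induced G snare"
        using T u ne sole by (intro snare_of_private_neighbours[of b c d u x y z]) auto
      then show False using no_snare by blast
    qed
  qed simp
  show ?thesis
  proof (rule path_cover_or_closed[OF deg])
    fix s assume "s \<in> S - {a}"
    then show "\<exists>x y. x \<noteq> y \<and> adj G s x \<and> adj G s y" using two_neighbours by blast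
  next
    fix p s assume cl: "alternating p" "set p \<inter> S \<subseteq> S - {a}" "s \<in> S - {a}" "s \<notin> set p"
      "hd p \<noteq> last p" "adj G s (hd p)" "adj G s (last p)"
    have "a \<notin> set (s # p)" using cl a by auto
    moreover have "\<not> adj G a t" if "t \<in> S \<inter> set (s # p)" for t
      using that a not_adj_S by blast
    ultimately have "\<exists>n\<ge>2. contains_induced G (nova n)"
      using closed_nova[OF cl(1) deg cl(2,3,4,6,7,5), of a] full a partition(1) by blast
    then show ?thesis using no_nova by blast
  next
    fix P assume "path_cover (S - {a}) P"
    then obtain c where c: "c \<noteq> []" "distinct c" "set c = (S - {a}) \<union> K" "hd c \<in> K" "last c \<in> K"
      "successively (adj G) c" using cover_cycle_list K_nonempty by blast
    have "a \<notin> K" using a partition(2) by blast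
    then have d: "distinct (a # c)" "set (a # c) = verts G" using c a partition(1) by auto
    then have "length (a # c) \<ge> 3" using three_vertices distinct_card by metis
    moreover have "successively (adj G) (a # c)"
      using c full by (simp add: successively_Cons)
    moreover have "adj G (last (a # c)) (hd (a # c))"
      using c(1) adj_sym[OF full[OF c(5)]] by simp
    ultimately show ?thesis
      using hamiltonian_cycle_listI[OF simple d] by blast
  qed
qed

text \<open>In the closed case a vertex of \<open>K\<close> off the path would be the hub of a nova,
  and a further vertex of \<open>S\<close> would be a third neighbour of \<open>hd p\<close> in
  \<open>S\<close>. So \<open>s # p\<close> is a Hamiltonian cycle.\<close>

lemma hamiltonian_if_degree_le_two:
  assumes deg: "degree_le_two S"
  shows "\<exists>C. hamiltonian_cycle G C"
proof (rule path_cover_or_closed[OF deg two_neighbours])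
  fix P assume "path_cover S P"
  then show ?thesis using hamiltonian_of_cover three_vertices K_nonempty by blast
next
  fix p s assume cl: "alternating p" "set p \<inter> S \<subseteq> S" "s \<in> S" "s \<notin> set p"
      "hd p \<noteq> last p" "adj G s (hd p)" "adj G s (last p)"
    and iso: "\<And>k t. k \<in> K \<Longrightarrow> k \<notin> set p \<Longrightarrow> t \<in> S \<inter> set (s # p) \<Longrightarrow> \<not> adj G t k"
  have "K \<subseteq> set p"
  proof
    fix w assume w: "w \<in> K"
    show "w \<in> set p"
    proof (rule ccontr)
      assume wp: "w \<notin> set p"
      have "w \<notin> set (s # p)" using w wp cl(3) partition(2) by auto
      moreover have "adj G w k" if "k \<in> K \<inter> set p" for k
        using that w wp adj_K by blast
      moreover have "\<not> adj G w t" if "t \<in> S \<inter> set (s # p)" for t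
        using iso[OF w wp that] adj_sym by metis
      ultimately have "\<exists>n\<ge>2. contains_induced G (nova n)"
        using closed_nova[OF cl(1) deg cl(2,3,4,6,7,5), of w] w partition(1) by blast
      then show False using no_nova by blast
    qed
  qed
  have S_sub: "S \<subseteq> set (s # p)"
  proof
    fix t assume t: "t \<in> S"
    show "t \<in> set (s # p)"
    proof (rule ccontr)
      assume tn: "t \<notin> set (s # p)"
      have only: "k = hd p \<or> k = last p" if "adj G t k" for k
        using alternating_end[OF cl(1) deg cl(2) _ t _ that] tn that t neighbour_S \<open>K \<subseteq> set p\<close> by auto
      \<comment> \<open>The vertex \<open>t\<close> has two neighbours and only the two ends of
        \<open>p\<close> are left for them, so it is adjacent to both.\<close>
      have "adj G t (hd p)"
        using only two_neighbours[OF t] by metis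
      obtain q where q: "p = hd p # q" "q \<noteq> []"
        using cl(1,5) by (cases p) (auto simp: alternating_def split: if_splits)
      then have "crossing (hd p) (hd q)"
        using cl(1) unfolding alternating_def by (metis successively_Cons)
      moreover have "hd p \<in> K" using cl(1) by (simp add: alternating_def)
      ultimately have "hd q \<in> S" "adj G (hd q) (hd p)"
        using crossing_K crossing_KS by blast+
      moreover have "hd q \<in> set p" using q by (metis hd_in_set list.set_intros(2))
      ultimately show False
        using degree_le_twoD[OF deg, of t "hd q" s "hd p"] \<open>adj G t (hd p)\<close> cl(3,4,6) t tn by auto
    qed
  qed
  have "set p \<subseteq> verts G"
  proof
    fix v assume "v \<in> set p"
    then obtain i where "i < length p" "v = p ! i" by (metis in_set_conv_nth)
    then show "v \<in> verts G"
      using alternating_nth[OF cl(1), of i] partition(1) by (auto split: if_splits)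
  qed
  then have d: "distinct (s # p)" "set (s # p) = verts G"
    using cl(1,3,4) S_sub \<open>K \<subseteq> set p\<close> partition(1) by (auto simp: alternating_def)
  then have "length (s # p) \<ge> 3" using three_vertices distinct_card by metis
  moreover have "p \<noteq> []" "successively (adj G) p"
    using cl(1) unfolding alternating_def by (auto intro: successively_mono simp: crossing_def)
  ultimately show ?thesis
    using hamiltonian_cycle_listI[OF simple d] cl(6,7) adj_sym[of G s "last p"]
    by (simp add: successively_Cons)
qed auto

section \<open>Two vertices of \<open>S\<close> with two common neighbours\<close>

text \<open>If \<open>r\<close> is a fourth vertex of \<open>S\<close>, two of its neighbours lie in a common one of the sets \<open>N(a)\<close>, \<open>N(b)\<close>,
  \<open>N(c)\<close>; the lemma is applied with each of the three in the role of \<open>a\<close>.\<close>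

lemma fourth_neighbours:
  assumes "r \<in> S" "a \<in> S" "b \<in> S" "c \<in> S" "r \<noteq> a" "r \<noteq> b" "r \<noteq> c"
    and z: "z \<in> K" "\<not> adj G a z" "adj G b z" "adj G c z"
    and xy: "y \<in> K" "\<not> adj G b y" "x \<in> K" "\<not> adj G c x"
    and v: "v \<noteq> v'" "adj G r v" "adj G r v'" "adj G a v" "adj G a v'" "adj G b v" "adj G c v'"
  shows "adj G r x \<and> adj G r y \<and> adj G r z"
proof -
  have rz: "adj G r z" using two_common_cover[of r a v v' z] assms by blast
  moreover have "v \<noteq> z" "v' \<noteq> z" using z v by auto
  ultimately show ?thesis
    using two_common_cover[of r b v z y] two_common_cover[of r c v' z x] assms by blast
qed

text \<open>Besides \<open>u\<close>, each pair of \<open>a\<close>, \<open>b\<close>,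
  \<open>c\<close> shares a vertex: \<open>x\<close> for \<open>a\<close>, \<open>b\<close>;
  \<open>y\<close> for \<open>a\<close>, \<open>c\<close>; \<open>z\<close> for \<open>b\<close>,
  \<open>c\<close>. If \<open>S\<close> has no further vertex, a path cover can be written down;
  otherwise \<open>S\<close> has exactly one more vertex, \<open>K = {u, x, y, z}\<close>, and the
  cycle is explicit.\<close>

lemma hamiltonian_if_two_common:
  assumes S: "a \<in> S" "b \<in> S" "c \<in> S" and ne: "a \<noteq> b" "a \<noteq> c" "b \<noteq> c"
    and u: "adj G a u" "adj G b u" "adj G c u"
    and x: "x \<noteq> u" "adj G a x" "adj G b x"
    and not_full: "\<And>s. s \<in> S \<Longrightarrow> \<exists>k\<in>K. \<not> adj G s k"
  shows "\<exists>C. hamiltonian_cycle G C"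
proof -
  have ab: "adj G a k \<or> adj G b k" if "k \<in> K" for k
    using two_common_cover[of a b u x k] S ne u x that by blast
  obtain z where z: "z \<in> K" "\<not> adj G a z" using not_full S by blast
  obtain y where y: "y \<in> K" "\<not> adj G b y" using not_full S by blast
  have bz: "adj G b z" and ay: "adj G a y" using ab z y by blast+
  have cx: "\<not> adj G c x" using no_two_common_of_three[of a b c u x] S ne u x by blast
  obtain v where v: "v \<noteq> u" "adj G c v" using two_neighbours[OF S(3)] by metis
  then have "adj G a v \<or> adj G b v" using ab S neighbour_S by blast
  \<comment> \<open>The second neighbour \<open>v\<close> of \<open>c\<close> is shared with
    \<open>a\<close> or \<open>b\<close>. With \<open>u\<close> this makes a second pair with two
    common neighbours, and \<open>two_common_cover\<close> gives one of the edges and then the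
    other.\<close>
  then have cyz: "adj G c y \<and> adj G c z"
  proof
    assume "adj G a v"
    then have "adj G c z" using two_common_cover[of a c u v z] S ne u v z by blast
    then show ?thesis using two_common_cover[of b c u z y] S ne u v y z bz by blast
  next
    assume "adj G b v"
    then have "adj G c y" using two_common_cover[of b c u v y] S ne u v y by blast
    then show ?thesis using two_common_cover[of a c u y z] S ne u v y z ay by blast
  qed
  have uK: "u \<in> K" "x \<in> K" using S u x neighbour_S by blast+
  have yu: "y \<noteq> u" "z \<noteq> u" "x \<noteq> y" "x \<noteq> z" "y \<noteq> z" using y z u x ay by auto
  have ac: "adj G a k \<or> adj G c k" if "k \<in> K" for k
    using two_common_cover[of a c u y k] S ne u ay cyz yu that by blast
  have bc: "adj G b k \<or> adj G c k" if "k \<in> K" for k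
    using two_common_cover[of b c u z k] S ne u bz cyz yu that by blast
  \<comment> \<open>Now \<open>u\<close> lies in all three neighbourhoods and every other vertex of \<open>K\<close> in exactly two.\<close>
  have only_u: "\<not> (adj G a k \<and> adj G b k \<and> adj G c k)" if "k \<noteq> u" for k
    using no_two_common_of_three[of a b c u k] S ne u that by blast
  have SK: "s \<noteq> k" "k \<noteq> s" if "s \<in> S" "k \<in> K" for s k using that partition(2) by auto
  have rest: "adj G r x \<and> adj G r y \<and> adj G r z" if r: "r \<in> S - {a, b, c}" for r
  proof -
    obtain p q where pq: "p \<noteq> q" "adj G r p" "adj G r q" using two_neighbours r by blast
    have K: "p \<in> K" "q \<in> K" using pq r neighbour_S by blast+
    have pair: "\<not> (adj G s p \<and> adj G s q \<and> adj G t p \<and> adj G t q)"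
      if "s \<in> {a, b, c}" "t \<in> {a, b, c}" "s \<noteq> t" for s t
      using no_two_common_of_three[of r s t p q] that r S pq by blast
    have nab: "\<not> (adj G a p \<and> adj G a q \<and> adj G b p \<and> adj G b q)"
      and nac: "\<not> (adj G a p \<and> adj G a q \<and> adj G c p \<and> adj G c q)"
      and nbc: "\<not> (adj G b p \<and> adj G b q \<and> adj G c p \<and> adj G c q)"
      using ne by (intro pair; simp)+
    have R: "r \<in> S" "r \<noteq> a" "r \<noteq> b" "r \<noteq> c" using r by auto
    \<comment> \<open>Each of \<open>p\<close> and \<open>q\<close> is adjacent to at least two of
      \<open>a\<close>, \<open>b\<close>, \<open>c\<close>, so one of these is adjacent to both. By
      \<open>pair\<close> it is the only one, and each of the other two sees exactly one of
      \<open>p\<close> and \<open>q\<close>. \<open>A\<close>, \<open>B\<close> and \<open>C\<close>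
      treat the three choices.\<close>
    have A: ?thesis if "adj G a p" "adj G a q" "adj G b p \<and> adj G c q \<or> adj G b q \<and> adj G c p"
      using that fourth_neighbours[of r a b c z y x p q] fourth_neighbours[of r a b c z y x q p]
        R S z y uK cx bz cyz pq by metis
    have B: ?thesis if "adj G b p" "adj G b q" "adj G a p \<and> adj G c q \<or> adj G a q \<and> adj G c p"
      using that fourth_neighbours[of r b a c y z x p q] fourth_neighbours[of r b a c y z x q p]
        R S z y uK cx ay cyz pq by metis
    have C: ?thesis if "adj G c p" "adj G c q" "adj G a p \<and> adj G b q \<or> adj G a q \<and> adj G b p"
      using that fourth_neighbours[of r c a b x z y p q] fourth_neighbours[of r c a b x z y q p]
        R S z y uK cx x pq by metis
    show ?thesis
      using A B C nab nac nbc ab[OF K(1)] ab[OF K(2)] ac[OF K(1)] ac[OF K(2)] bc[OF K(1)] bc[OF K(2)]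
      by argo
  qed
  show ?thesis
  proof (cases "S = {a, b, c}")
    case True
    \<comment> \<open>Here \<open>x\<close> links \<open>a\<close> to \<open>b\<close> and
      \<open>z\<close> links \<open>b\<close> to \<open>c\<close>; the rest of \<open>K\<close> is
      covered by one-vertex paths.\<close>
    let ?p = "[y, a, x, b, z, c, u]"
    have "alternating ?p"
      using S uK y(1) z(1) yu x ne u ay bz cyz SK
      by (auto simp: alternating_def crossing_SK crossing_KS)
    moreover have "{a, b, c} \<inter> K = {}" using S partition(2) by blast
    ultimately have "path_cover {a, b, c} (insert ?p ((\<lambda>k. [k]) ` (K - {x, y, z, u})))"
      unfolding path_cover_def using finite_K uK y(1) z(1)
      by (auto simp: alternating_def)
    then have "path_cover S (insert ?p ((\<lambda>k. [k]) ` (K - {x, y, z, u})))"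
      using True by simp
    then show ?thesis using hamiltonian_of_cover three_vertices K_nonempty by blast
  next
    case False
    then obtain r where r: "r \<in> S" "r \<noteq> a" "r \<noteq> b" "r \<noteq> c" using S by blast
    then have rxyz: "adj G r x" "adj G r y" "adj G r z" using rest by auto
    have K: "K = {u, x, y, z}"
    proof -
      have "k \<in> {u, x, y, z}" if k: "k \<in> K" for k
      proof (rule ccontr)
        \<comment> \<open>If \<open>r\<close> missed \<open>k\<close>, then \<open>a\<close>,
          \<open>b\<close> and \<open>c\<close> would all see \<open>k\<close>, which happens only
          for \<open>u\<close>. So \<open>r\<close> sees \<open>k\<close>, and so do two of
          \<open>a\<close>, \<open>b\<close>, \<open>c\<close>; these three also share one of
          \<open>x\<close>, \<open>y\<close>, \<open>z\<close>.\<close>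
        assume nk: "k \<notin> {u, x, y, z}"
        have "adj G r k \<or> adj G a k" using two_common_cover[of r a x y k] r S rxyz x ay yu k by blast
        moreover have "adj G r k \<or> adj G b k" using two_common_cover[of r b x z k] r S rxyz x bz yu k by blast
        moreover have "adj G r k \<or> adj G c k" using two_common_cover[of r c y z k] r S rxyz cyz yu k by blast
        ultimately have "adj G r k" using only_u nk by blast
        moreover have "\<not> (adj G r k \<and> adj G a k \<and> adj G b k)"
          using no_two_common_of_three[of r a b x k] r S ne rxyz x nk by blast
        moreover have "\<not> (adj G r k \<and> adj G a k \<and> adj G c k)"
          using no_two_common_of_three[of r a c y k] r S ne rxyz ay cyz nk by blast
        moreover have "\<not> (adj G r k \<and> adj G b k \<and> adj G c k)"
          using no_two_common_of_three[of r b c z k] r S ne rxyz bz cyz nk by blast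
        ultimately show False using ab[OF k] ac[OF k] bc[OF k] by blast
      qed
      then show ?thesis using uK y z by blast
    qed
    have "t \<in> {a, b, c, r}" if t: "t \<in> S" for t
    proof (rule ccontr)
      assume nt: "t \<notin> {a, b, c, r}"
      then have "adj G t x" "adj G t y" using rest t by auto
      then show False
        using no_two_common_of_three[of t r a x y] nt t r S rxyz x ay yu by blast
    qed
    then have SE: "S = {a, b, c, r}" using S r by blast
    \<comment> \<open>The vertex \<open>r\<close> goes between \<open>z\<close> and
      \<open>y\<close>, and \<open>c\<close> returns to \<open>u\<close>.\<close>
    let ?c = "[u, a, x, b, z, r, y, c]"
    have "distinct ?c" using yu x ne r S uK y(1) z(1) SK by auto
    moreover have "set ?c = verts G" using SE K partition(1) by auto
    moreover have "successively (adj G) ?c" "adj G (last ?c) (hd ?c)"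
      using u x bz rxyz cyz adj_sym[of G] by auto
    ultimately show ?thesis
      by (intro hamiltonian_cycle_listI[OF simple, of ?c]) auto
  qed
qed

section \<open>The case distinction and the passage from 2-connectedness\<close>

text \<open>In the remaining case some \<open>u\<close> has three neighbours in \<open>S\<close>. If
  each of them had a private neighbour, there would be a snare; so one shares a neighbour besides
  \<open>u\<close> with another.\<close>

lemma hamiltonian: "\<exists>C. hamiltonian_cycle G C"
proof (cases "\<exists>s\<in>S. \<forall>k\<in>K. adj G s k")
  case True
  then show ?thesis using hamiltonian_if_full by blast
next
  case nf: False
  show ?thesis
  proof (cases "degree_le_two S")
    case True
    then show ?thesis by (rule hamiltonian_if_degree_le_two)
  next
    case False
    then obtain u a b c where S: "a \<in> S" "b \<in> S" "c \<in> S" and ne: "a \<noteq> b" "a \<noteq> c" "b \<noteq> c"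
      and u: "adj G a u" "adj G b u" "adj G c u"
      unfolding degree_le_two_def by blast
    \<comment> \<open>Without a private neighbour of \<open>s\<close>, its neighbour other than
      \<open>u\<close> is shared with \<open>t\<close> or \<open>r\<close>.\<close>
    have *: ?thesis if "s \<in> S" "t \<in> S" "r \<in> S" "s \<noteq> t" "s \<noteq> r" "t \<noteq> r"
        "adj G s u" "adj G t u" "adj G r u"
        and priv: "\<not> (\<exists>x. adj G s x \<and> \<not> adj G t x \<and> \<not> adj G r x)" for s t r
    proof -
      obtain x where x: "x \<noteq> u" "adj G s x" using two_neighbours \<open>s \<in> S\<close> by metis
      then consider "adj G t x" | "adj G r x" using priv by blast
      then show ?thesis
      proof cases
        case 1
        then show ?thesis using hamiltonian_if_two_common[of s t r u x] that x nf by metis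
      next
        case 2
        then show ?thesis using hamiltonian_if_two_common[of s r t u x] that x nf by metis
      qed
    qed
    show ?thesis
    proof (rule ccontr)
      assume nh: "\<not> ?thesis"
      obtain x where "adj G a x" "\<not> adj G b x" "\<not> adj G c x" using *[of a b c] S ne u nh by blast
      moreover obtain y where "adj G b y" "\<not> adj G a y" "\<not> adj G c y" using *[of b a c] S ne u nh by blast
      moreover obtain z where "adj G c z" "\<not> adj G a z" "\<not> adj G b z" using *[of c a b] S ne u nh by blast
      ultimately show False
        using snare_of_private_neighbours[of a b c u x y z] S u no_snare by blast
    qed
  qed
qed

end

theorem theorem6:
  fixes G :: "'a graph"
  assumes "simple_graph G"
    and "k_connected 2 G"
    and "split_graph G"
    and "\<not> contains_induced G snare"
    and "\<And>n. n \<ge> 2 \<Longrightarrow> \<not> contains_induced G (nova n)"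
  shows "\<exists>C. hamiltonian_cycle G C"
proof -
  obtain S K where SK: "S \<union> K = verts G" "S \<inter> K = {}" "indep S (edges G)" "clique K (edges G)"
    using assms(3) unfolding split_graph_def by blast
  interpret split_partition G S K
    using assms(1) SK by unfold_locales
  have "\<exists>x y. x \<noteq> y \<and> adj G s x \<and> adj G s y" if s: "s \<in> S" for s
  proof -
    have sv: "s \<in> verts G" using s SK(1) by blast
    have card: "card (verts G) > 2" using assms(2) by (simp add: k_connected_def)
    then have "verts G \<noteq> {s}" by auto
    \<comment> \<open>Avoiding an arbitrary \<open>v\<close> yields a first neighbour
      \<open>x\<close>; avoiding \<open>x\<close> then yields a second one.\<close>
    then obtain v where "v \<noteq> s" using sv by blast
    then obtain x where x: "adj G s x" using two_connected_neighbour[OF assms(2) sv] by metis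
    then have "x \<noteq> s" using adj_irrefl by blast
    then obtain y where "adj G s y" "y \<noteq> x" using two_connected_neighbour[OF assms(2) sv] by metis
    then show ?thesis using x by blast
  qed
  then interpret snare_nova_free G S K
    using assms(2,4,5) by unfold_locales (auto simp: k_connected_def)
  show ?thesis by (rule hamiltonian)
qed

end
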